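(* Consider the discretely monitored up-and-out option in the Black--Scholes model with payoff $$g=\max\left(f(S_1(t_1),\ldots,S_n(t_m)),0\right)\,\mathbb{I}\left\{\max_{j=1,\ldots,m}S_1(t_j)<B\right\},$$ where all asset prices are generated from a random vector $(u_1,\ldots,u_{mn})$ uniformly distributed on $(0,1)^{mn}$ (regular Monte Carlo) via a matrix $A$ with $AA'=\widetilde\Sigma$ and $a_{j,1}\ne 0$ for $j=1,\ldots,m$. Let $\Upsilon_d=\Upsilon_d(u_2,\ldots,u_{mn})$ and $\Upsilon_u=\Upsilon_u(u_2,\ldots,u_{mn})$ be the lower and upper bounds on $u_1$ implied by the barrier condition, put $\hat u_1=\Upsilon_d+(\Upsilon_u-\Upsilon_d)u_1$, and define $$\hat g_2=\max(\Upsilon_u-\Upsilon_d,0)\,\max\left(f(\hat u_1,u_2,\ldots,u_{mn}),0\right).$$ Then $\operatorname{Var}[\hat g_2]\le\operatorname{Var}[g]$. Moreover, the inequality is strict if $\mathbb{P}\left[\max_{j}S_1(t_j)\ge B\right]>0$ and $\mathbb{E}[g]>0$.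
   Context: Model. Let $n,m\ge 1$ be integers, $r\in\mathbb{R}$, $T>0$, $\Delta t=T/m$, $t_j=j\Delta t$ for $j=0,\ldots,m$. There are $n$ assets with initial prices $S_i(0)>0$, volatilities $\sigma_i>0$ and correlation matrix $(\rho_{ij})$, and $S_i(t)=S_i(0)e^{(r-\sigma_i^2/2)t+\sigma_iW_i(t)}$, where $(W_1,\ldots,W_n)$ is a Brownian motion with $dW_i\,dW_j=\rho_{ij}\,dt$. The vector $\widetilde{W}=(\sigma_1W_1(t_1),\ldots,\sigma_1W_1(t_m),\sigma_2W_2(t_1),\ldots,\sigma_nW_n(t_m))'$ is centred Gaussian with $mn\times mn$ covariance matrix $\widetilde\Sigma$ whose entry for $(\sigma_iW_i(t_k),\sigma_jW_j(t_l))$ is $\rho_{ij}\sigma_i\sigma_j\min(k,l)\Delta t$. Path construction. $A=(a_{j,i})$ is a real $mn\times mn$ matrix with $AA'=\widetilde\Sigma$ (prime denotes transpose). $\Phi$ is the standard normal cumulative distribution function. Given $u=(u_1,\ldots,u_{mn})\in(0,1)^{mn}$, set $z_i=\Phi^{-1}(u_i)$ and $\widetilde{W}=Az$; this determines all prices: $S_i(t_j)=S_i(0)\exp\left((r-\sigma_i^2/2)t_j+(Az)_{(i-1)m+j}\right)$. When $u$ is uniform on $(0,1)^{mn}$ this gives the correct joint law of the prices. $f$ is a real-valued (measurable) function of the prices $(S_i(t_j))_{i,j}$; $f(u_1,\ldots,u_{mn})$ denotes its value at the prices generated from $u$. $B>0$ is the barrier level. It is assumed that $\mathbb{E}[g^2]<\infty$,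 so that variances are meaningful. Bounds. Let $b(t_j)=\log(B/S_1(0))-(r-\sigma_1^2/2)t_j$, and $$q_j(u_2,\ldots,u_{mn})=\frac{b(t_j)-a_{j,2}\Phi^{-1}(u_2)-\cdots-a_{j,mn}\Phi^{-1}(u_{mn})}{a_{j,1}},\qquad j=1,\ldots,m.$$ Let $\mathcal{P}=\{j\in\{1,\ldots,m\}:a_{j,1}>0\}$, so that $a_{j,1}<0$ for $j\in\{1,\ldots,m\}\setminus\mathcal{P}$. Then $\Upsilon_u=\Phi(\min_{j\in\mathcal{P}}q_j)$ (with $\Upsilon_u=1$ if $\mathcal{P}=\emptyset$) and $\Upsilon_d=\Phi(\max_{j\in\{1,\ldots,m\}\setminus\mathcal{P}}q_j)$ (with $\Upsilon_d=0$ if $\mathcal{P}=\{1,\ldots,m\}$). The value of $\hat g_2$ is taken to be $0$ whenever $\Upsilon_u\le\Upsilon_d$. *)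

theory Defs
  imports "HOL-Probability.Probability"
begin

definition std_normal_cdf :: "real \<Rightarrow> real" where
  "std_normal_cdf = cdf std_normal_distribution"

text \<open>
  The function \<^term>\<open>std_normal_cdf\<close> is injective with range \<open>{0<..<1}\<close>, so its \<open>inv\<close> is the
  quantile function on \<open>{0<..<1}\<close>. Outside this interval its value is an irrelevant constant.
\<close>

definition std_normal_quantile :: "real \<Rightarrow> real" where
  "std_normal_quantile = inv std_normal_cdf"

definition correlation_matrix :: "nat \<Rightarrow> (nat \<Rightarrow> nat \<Rightarrow> real) \<Rightarrow> bool" where
  "correlation_matrix n \<rho> \<longleftrightarrow>
     (\<forall>i\<in>{1..n}. \<rho> i i = 1) \<and>
     (\<forall>i\<in>{1..n}. \<forall>j\<in>{1..n}. \<rho> i j = \<rho> j i) \<and>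
     (\<forall>x :: nat \<Rightarrow> real. 0 \<le> (\<Sum>i=1..n. \<Sum>j=1..n. x i * \<rho> i j * x j))"

definition monitoring_time :: "nat \<Rightarrow> real \<Rightarrow> nat \<Rightarrow> real" where
  "monitoring_time m T j = real j * (T / real m)"

text \<open>
  All indices are 1-based. Asset \<open>i\<close> at date \<open>t\<^sub>j\<close> occupies position \<open>(i - 1) m + j\<close> of the
  vectors of length \<open>m n\<close>; a square matrix of that size is a function of which only the entries
  with both indices in \<open>{1..m * n}\<close> matter.
\<close>

definition row_index :: "nat \<Rightarrow> nat \<Rightarrow> nat \<Rightarrow> nat" where
  "row_index m i j = (i - 1) * m + j"

text \<open>
  The matrix identity \<open>A A' = \<Sigma>\<close>, where \<open>\<Sigma>\<close> is the covariance matrix of the random variables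
  \<open>\<sigma>\<^sub>i W\<^sub>i(t\<^sub>k)\<close>, spelled out entry by entry.
\<close>

definition path_matrix ::
  "nat \<Rightarrow> nat \<Rightarrow> real \<Rightarrow> (nat \<Rightarrow> real) \<Rightarrow> (nat \<Rightarrow> nat \<Rightarrow> real) \<Rightarrow> (nat \<Rightarrow> nat \<Rightarrow> real) \<Rightarrow> bool" where
  "path_matrix n m T \<sigma> \<rho> A \<longleftrightarrow>
     (\<forall>i\<in>{1..n}. \<forall>k\<in>{1..m}. \<forall>j\<in>{1..n}. \<forall>l\<in>{1..m}.
        (\<Sum>h=1..m*n. A (row_index m i k) h * A (row_index m j l) h)
          = \<rho> i j * \<sigma> i * \<sigma> j * real (min k l) * (T / real m))"

definition asset_price ::
  "nat \<Rightarrow> nat \<Rightarrow> real \<Rightarrow> real \<Rightarrow> (nat \<Rightarrow> real) \<Rightarrow> (nat \<Rightarrow> real) \<Rightarrow> (nat \<Rightarrow> nat \<Rightarrow> real) \<Rightarrow>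
   (nat \<Rightarrow> real) \<Rightarrow> nat \<Rightarrow> nat \<Rightarrow> real" where
  "asset_price n m r T S0 \<sigma> A u i j =
     S0 i * exp ((r - (\<sigma> i)\<^sup>2 / 2) * monitoring_time m T j
                 + (\<Sum>h=1..m*n. A (row_index m i j) h * std_normal_quantile (u h)))"

definition price_array ::
  "nat \<Rightarrow> nat \<Rightarrow> real \<Rightarrow> real \<Rightarrow> (nat \<Rightarrow> real) \<Rightarrow> (nat \<Rightarrow> real) \<Rightarrow> (nat \<Rightarrow> nat \<Rightarrow> real) \<Rightarrow>
   (nat \<Rightarrow> real) \<Rightarrow> nat \<times> nat \<Rightarrow> real" where
  "price_array n m r T S0 \<sigma> A u =
     restrict (\<lambda>(i, j). asset_price n m r T S0 \<sigma> A u i j) ({1..n} \<times> {1..m})"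

definition max_price ::
  "nat \<Rightarrow> nat \<Rightarrow> real \<Rightarrow> real \<Rightarrow> (nat \<Rightarrow> real) \<Rightarrow> (nat \<Rightarrow> real) \<Rightarrow> (nat \<Rightarrow> nat \<Rightarrow> real) \<Rightarrow>
   (nat \<Rightarrow> real) \<Rightarrow> real" where
  "max_price n m r T S0 \<sigma> A u = Max ((\<lambda>j. asset_price n m r T S0 \<sigma> A u 1 j) ` {1..m})"

definition up_and_out_payoff ::
  "nat \<Rightarrow> nat \<Rightarrow> real \<Rightarrow> real \<Rightarrow> (nat \<Rightarrow> real) \<Rightarrow> (nat \<Rightarrow> real) \<Rightarrow> (nat \<Rightarrow> nat \<Rightarrow> real) \<Rightarrow> real \<Rightarrow>
   ((nat \<times> nat \<Rightarrow> real) \<Rightarrow> real) \<Rightarrow> (nat \<Rightarrow> real) \<Rightarrow> real" where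
  "up_and_out_payoff n m r T S0 \<sigma> A B f u =
     max (f (price_array n m r T S0 \<sigma> A u)) 0 *
     (if max_price n m r T S0 \<sigma> A u < B then 1 else 0)"

definition log_barrier ::
  "nat \<Rightarrow> real \<Rightarrow> real \<Rightarrow> (nat \<Rightarrow> real) \<Rightarrow> (nat \<Rightarrow> real) \<Rightarrow> real \<Rightarrow> nat \<Rightarrow> real" where
  "log_barrier m r T S0 \<sigma> B j =
     ln (B / S0 1) - (r - (\<sigma> 1)\<^sup>2 / 2) * monitoring_time m T j"

definition barrier_quantile ::
  "nat \<Rightarrow> nat \<Rightarrow> real \<Rightarrow> real \<Rightarrow> (nat \<Rightarrow> real) \<Rightarrow> (nat \<Rightarrow> real) \<Rightarrow> (nat \<Rightarrow> nat \<Rightarrow> real) \<Rightarrow> real \<Rightarrow>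
   (nat \<Rightarrow> real) \<Rightarrow> nat \<Rightarrow> real" where
  "barrier_quantile n m r T S0 \<sigma> A B u j =
     (log_barrier m r T S0 \<sigma> B j - (\<Sum>h=2..m*n. A j h * std_normal_quantile (u h))) / A j 1"

definition pos_dates :: "nat \<Rightarrow> (nat \<Rightarrow> nat \<Rightarrow> real) \<Rightarrow> nat set" where
  "pos_dates m A = {j \<in> {1..m}. A j 1 > 0}"

definition upper_bound ::
  "nat \<Rightarrow> nat \<Rightarrow> real \<Rightarrow> real \<Rightarrow> (nat \<Rightarrow> real) \<Rightarrow> (nat \<Rightarrow> real) \<Rightarrow> (nat \<Rightarrow> nat \<Rightarrow> real) \<Rightarrow> real \<Rightarrow>
   (nat \<Rightarrow> real) \<Rightarrow> real" where
  "upper_bound n m r T S0 \<sigma> A B u =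
     (if pos_dates m A = {} then 1
      else std_normal_cdf (Min (barrier_quantile n m r T S0 \<sigma> A B u ` pos_dates m A)))"

definition lower_bound ::
  "nat \<Rightarrow> nat \<Rightarrow> real \<Rightarrow> real \<Rightarrow> (nat \<Rightarrow> real) \<Rightarrow> (nat \<Rightarrow> real) \<Rightarrow> (nat \<Rightarrow> nat \<Rightarrow> real) \<Rightarrow> real \<Rightarrow>
   (nat \<Rightarrow> real) \<Rightarrow> real" where
  "lower_bound n m r T S0 \<sigma> A B u =
     (if pos_dates m A = {1..m} then 0
      else std_normal_cdf (Max (barrier_quantile n m r T S0 \<sigma> A B u ` ({1..m} - pos_dates m A))))"

definition shifted_first ::
  "nat \<Rightarrow> nat \<Rightarrow> real \<Rightarrow> real \<Rightarrow> (nat \<Rightarrow> real) \<Rightarrow> (nat \<Rightarrow> real) \<Rightarrow> (nat \<Rightarrow> nat \<Rightarrow> real) \<Rightarrow> real \<Rightarrow>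
   (nat \<Rightarrow> real) \<Rightarrow> real" where
  "shifted_first n m r T S0 \<sigma> A B u =
     lower_bound n m r T S0 \<sigma> A B u
     + (upper_bound n m r T S0 \<sigma> A B u - lower_bound n m r T S0 \<sigma> A B u) * u 1"

text \<open>
  If the upper bound does not exceed the lower bound, the first factor is \<open>0\<close> and hence so is the
  estimator, whatever the value of \<open>f\<close>.
\<close>

definition conditional_estimator ::
  "nat \<Rightarrow> nat \<Rightarrow> real \<Rightarrow> real \<Rightarrow> (nat \<Rightarrow> real) \<Rightarrow> (nat \<Rightarrow> real) \<Rightarrow> (nat \<Rightarrow> nat \<Rightarrow> real) \<Rightarrow> real \<Rightarrow>
   ((nat \<times> nat \<Rightarrow> real) \<Rightarrow> real) \<Rightarrow> (nat \<Rightarrow> real) \<Rightarrow> real" where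
  "conditional_estimator n m r T S0 \<sigma> A B f u =
     max (upper_bound n m r T S0 \<sigma> A B u - lower_bound n m r T S0 \<sigma> A B u) 0 *
     max (f (price_array n m r T S0 \<sigma> A (u(1 := shifted_first n m r T S0 \<sigma> A B u)))) 0"

end

theory Submission
  imports Defs
begin

text \<open>
  Write \<open>H\<close> for the payoff without barrier, and let \<open>d\<close>, \<open>w\<close> be the lower and upper bounds and
  \<open>c = max (w - d) 0\<close>; these three depend only on \<open>u\<^sub>2, u\<^sub>3, \<dots>\<close>. The barrier condition is
  \<open>d < u\<^sub>1 < w\<close>, so the substitution \<open>u\<^sub>1 \<mapsto> d + (w - d) u\<^sub>1\<close> in the innermost integral gives
  \<open>E[g\<^sub>2] = E[g]\<close> and, applied to \<open>c H\<^sup>2\<close> in place of \<open>H\<close>, \<open>E[g\<^sub>2\<^sup>2] = E[c g\<^sup>2]\<close>. Hence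
  \<open>Var[g] - Var[g\<^sub>2] = E[(1 - c) g\<^sup>2]\<close>, and \<open>c < 1\<close> everywhere.
\<close>

section \<open>The standard normal distribution function and its quantile function\<close>

text \<open>The normal density is positive everywhere, so an interval of normal measure 0 would have
  Lebesgue measure 0 as well. The increment of the cdf over \<open>{a<..b}\<close> is therefore
  positive.\<close>

lemma std_normal_cdf_strict_mono: "strict_mono std_normal_cdf"
proof (rule strict_monoI)
  interpret real_distribution std_normal_distribution
    by (rule real_dist_normal_dist)
  fix a b :: real
  assume "a < b"
  have "emeasure std_normal_distribution {a<..b} \<noteq> 0"
  proof
    assume "emeasure std_normal_distribution {a<..b} = 0"
    then have "AE x in lborel. x \<notin> {a<..b}"
      by (subst (asm) emeasure_density)
         (auto simp: nn_integral_0_iff_AE indicator_def normal_density_def max_def elim!: eventually_mono)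
    then have "emeasure lborel {a<..b} = 0"
      by (subst (asm) AE_iff_measurable[of "{a<..b}"]) auto
    with \<open>a < b\<close> show False by simp
  qed
  then have "0 < measure std_normal_distribution {a<..b}"
    by (simp add: emeasure_eq_measure zero_less_measure_iff)
  with cdf_diff_eq[OF \<open>a < b\<close>] show "std_normal_cdf a < std_normal_cdf b"
    by (simp add: std_normal_cdf_def)
qed

lemmas std_normal_cdf_less_iff [simp] = strict_mono_less[OF std_normal_cdf_strict_mono]

text \<open>A distribution function is continuous wherever its measure has no atom, and a measure
  with a Lebesgue density has none.\<close>

lemma isCont_std_normal_cdf: "isCont std_normal_cdf x"
proof -
  interpret real_distribution std_normal_distribution
    by (rule real_dist_normal_dist)
  have "emeasure std_normal_distribution {x} = 0"
    by (subst emeasure_density)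
       (auto simp: nn_integral_0_iff_AE indicator_def intro: eventually_mono[OF AE_lborel_singleton[of x]])
  then show ?thesis
    by (simp add: std_normal_cdf_def isCont_cdf measure_def)
qed

text \<open>Every cdf lies weakly between 0 and 1; comparing \<open>x\<close> with its neighbours
  \<open>x - 1\<close> and \<open>x + 1\<close> makes both bounds strict.\<close>

lemma std_normal_cdf_bounds: "0 < std_normal_cdf x" "std_normal_cdf x < 1"
proof -
  interpret real_distribution std_normal_distribution
    by (rule real_dist_normal_dist)
  have "0 \<le> std_normal_cdf (x - 1)" "std_normal_cdf (x + 1) \<le> 1"
    by (simp_all add: std_normal_cdf_def cdf_nonneg cdf_bounded_prob)
  moreover have "std_normal_cdf (x - 1) < std_normal_cdf x" "std_normal_cdf x < std_normal_cdf (x + 1)"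
    by simp_all
  ultimately show "0 < std_normal_cdf x" "std_normal_cdf x < 1"
    by linarith+
qed

text \<open>The limits 0 and 1 at the two ends put any \<open>y\<close> of the open interval
  strictly between two values of the cdf, and the intermediate value theorem supplies a
  preimage.\<close>

lemma range_std_normal_cdf: "range std_normal_cdf = {0<..<1}"
proof (intro set_eqI iffI)
  interpret real_distribution std_normal_distribution
    by (rule real_dist_normal_dist)
  fix y :: real
  assume y: "y \<in> {0<..<1}"
  have "eventually (\<lambda>x. std_normal_cdf x < y) at_bot"
    unfolding std_normal_cdf_def using cdf_lim_at_bot y by (intro order_tendstoD) auto
  then obtain a where a: "std_normal_cdf a < y"
    using eventually_happens' trivial_limit_at_bot_linorder by blast
  have "eventually (\<lambda>x. y < std_normal_cdf x) at_top"
    unfolding std_normal_cdf_def using cdf_lim_at_top_prob y by (intro order_tendstoD) auto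
  then obtain b where b: "y < std_normal_cdf b"
    using eventually_happens' trivial_limit_at_top_linorder by blast
  have "a \<le> b"
    using order.strict_trans[OF a b] by simp
  with a b have "\<exists>x\<ge>a. x \<le> b \<and> std_normal_cdf x = y"
    by (intro IVT) (auto simp: isCont_std_normal_cdf)
  then show "y \<in> range std_normal_cdf"
    by auto
next
  fix y
  assume "y \<in> range std_normal_cdf"
  then show "y \<in> {0<..<1}"
    using std_normal_cdf_bounds by auto
qed

lemma std_normal_cdf_quantile: "y \<in> {0<..<1} \<Longrightarrow> std_normal_cdf (std_normal_quantile y) = y"
  unfolding std_normal_quantile_def by (simp add: f_inv_into_f range_std_normal_cdf)

lemma borel_measurable_std_normal_cdf [measurable]: "std_normal_cdf \<in> borel_measurable borel"
  by (intro borel_measurable_continuous_onI continuous_at_imp_continuous_on)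
     (auto simp: isCont_std_normal_cdf)

text \<open>The quantile function is monotone only on the open unit interval. A sublevel set is an
  initial piece of that interval together with all or none of its complement, where the function is
  constant.\<close>

lemma borel_measurable_std_normal_quantile [measurable]: "std_normal_quantile \<in> borel_measurable borel"
proof (rule borel_measurableI_le)
  fix a :: real
  \<comment> \<open>For \<open>y\<close> without a preimage, \<open>inv\<close> chooses from the
    empty predicate; this is the resulting default value.\<close>
  define c where "c = (SOME x::real. False)"
  have outside: "std_normal_quantile y = c" if "y \<notin> {0<..<1}" for y
  proof -
    have "std_normal_cdf x \<noteq> y" for x
      using that std_normal_cdf_bounds[of x] by auto
    then show ?thesis
      by (simp add: std_normal_quantile_def inv_into_def c_def)
  qed
  have inside: "std_normal_quantile y \<le> a \<longleftrightarrow> y \<le> std_normal_cdf a" if "y \<in> {0<..<1}" for y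
    using std_normal_cdf_less_iff[of a "std_normal_quantile y"] std_normal_cdf_quantile[OF that]
    by (metis not_less)
  have "{y \<in> space borel. std_normal_quantile y \<le> a} =
      {0<..<1} \<inter> {..std_normal_cdf a} \<union> (if c \<le> a then - {0<..<1} else {})"
  proof (intro set_eqI)
    fix y
    show "y \<in> {y \<in> space borel. std_normal_quantile y \<le> a} \<longleftrightarrow>
        y \<in> {0<..<1} \<inter> {..std_normal_cdf a} \<union> (if c \<le> a then - {0<..<1} else {})"
      by (cases "y \<in> {0<..<1}") (simp_all add: inside outside del: greaterThanLessThan_iff)
  qed
  also have "\<dots> \<in> sets borel"
    by auto
  finally show "{y \<in> space borel. std_normal_quantile y \<le> a} \<in> sets borel" .
qed

section \<open>Resampling one coordinate of the uniform cube\<close>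

text \<open>
  The substitution \<open>y \<mapsto> d + (w - d) y\<close> has Jacobian \<open>w - d\<close>, which is the prefactor; for
  \<open>w \<le> d\<close> both sides vanish.
\<close>

lemma nn_integral_rescale_unit_interval:
  fixes d w :: real and \<phi> :: "real \<Rightarrow> ennreal"
  assumes [measurable]: "\<phi> \<in> borel_measurable borel" and "0 \<le> d" "w \<le> 1"
  shows "(\<integral>\<^sup>+y. ennreal (max (w - d) 0) * \<phi> (d + (w - d) * y) * indicator {0<..<1} y \<partial>lborel) =
         (\<integral>\<^sup>+y. \<phi> y * indicator {d<..<w} y * indicator {0<..<1} y \<partial>lborel)"
proof (cases "d < w")
  case False
  then have "{d<..<w} = {}" "max (w - d) 0 = 0"
    by auto
  then show ?thesis by simp
next
  case True
  \<comment> \<open>Since \<open>0 \<le> d\<close> and \<open>w \<le> 1\<close>, the interval from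
    \<open>d\<close> to \<open>w\<close> lies inside the unit interval, which absorbs the second
    indicator.\<close>
  have "(\<integral>\<^sup>+y. \<phi> y * indicator {d<..<w} y * indicator {0<..<1} y \<partial>lborel) =
        (\<integral>\<^sup>+y. \<phi> y * indicator {d<..<w} y \<partial>lborel)"
    using assms by (intro nn_integral_cong) (auto simp: indicator_def)
  also have "\<dots> = \<bar>w - d\<bar> * (\<integral>\<^sup>+y. \<phi> (d + (w - d) * y) * indicator {d<..<w} (d + (w - d) * y) \<partial>lborel)"
    using True by (intro nn_integral_real_affine) auto
  also have "\<dots> = (\<integral>\<^sup>+y. ennreal (w - d) * (\<phi> (d + (w - d) * y) * indicator {d<..<w} (d + (w - d) * y)) \<partial>lborel)"
    using True by (subst nn_integral_cmult) auto
  also have "\<dots> = (\<integral>\<^sup>+y. ennreal (max (w - d) 0) * \<phi> (d + (w - d) * y) * indicator {0<..<1} y \<partial>lborel)"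
  proof (intro nn_integral_cong)
    fix y :: real
    have "d + (w - d) * y < w \<longleftrightarrow> (w - d) * y < (w - d) * 1"
      by auto
    then have "indicator {d<..<w} (d + (w - d) * y) = (indicator {0<..<1} y :: ennreal)"
      using True unfolding mult_less_cancel_left_pos[OF diff_gt_0_iff_gt[THEN iffD2, OF True]]
      by (auto simp: indicator_def zero_less_mult_iff)
    with True show "ennreal (w - d) * (\<phi> (d + (w - d) * y) * indicator {d<..<w} (d + (w - d) * y)) =
        ennreal (max (w - d) 0) * \<phi> (d + (w - d) * y) * indicator {0<..<1} y"
      by (simp add: mult.assoc max_def)
  qed
  finally show ?thesis ..
qed

text \<open>By Tonelli, coordinate \<open>i\<close> can be integrated first. The update hypotheses
  make \<open>d\<close> and \<open>w\<close> constant along each such fibre, so the one-dimensional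
  substitution applies with fixed endpoints.\<close>

lemma nn_integral_resample_coordinate:
  fixes d w :: "('i \<Rightarrow> real) \<Rightarrow> real" and \<phi> :: "('i \<Rightarrow> real) \<Rightarrow> ennreal"
  assumes "finite I" "i \<in> I"
    and [measurable]: "d \<in> borel_measurable (\<Pi>\<^sub>M h\<in>I. lborel)" "w \<in> borel_measurable (\<Pi>\<^sub>M h\<in>I. lborel)"
      "\<phi> \<in> borel_measurable (\<Pi>\<^sub>M h\<in>I. lborel)"
    and d_upd: "\<And>u y. d (u(i := y)) = d u" and w_upd: "\<And>u y. w (u(i := y)) = w u"
    and "\<And>u. 0 \<le> d u" "\<And>u. w u \<le> 1"
  shows "(\<integral>\<^sup>+u. ennreal (max (w u - d u) 0) * \<phi> (u(i := d u + (w u - d u) * u i)) *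
            indicator (\<Pi>\<^sub>E h\<in>I. {0<..<1}) u \<partial>(\<Pi>\<^sub>M h\<in>I. lborel)) =
         (\<integral>\<^sup>+u. \<phi> u * indicator {d u<..<w u} (u i) * indicator (\<Pi>\<^sub>E h\<in>I. {0<..<1}) u \<partial>(\<Pi>\<^sub>M h\<in>I. lborel))"
proof -
  interpret product_sigma_finite "\<lambda>_::'i. lborel :: real measure"
    by standard
  obtain J where I: "I = insert i J" and J: "i \<notin> J" "finite J"
    using \<open>i \<in> I\<close> \<open>finite I\<close> by (metis finite_insert mk_disjoint_insert)
  have [measurable]: "(\<lambda>u. u i) \<in> borel_measurable (\<Pi>\<^sub>M h\<in>I. lborel)"
    using measurable_component_singleton[of i I "\<lambda>_. lborel"] \<open>i \<in> I\<close> by simp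
  have [measurable]: "(\<Pi>\<^sub>E h\<in>I. {0<..<1::real}) \<in> sets (\<Pi>\<^sub>M h\<in>I. lborel)"
    using \<open>finite I\<close> by (intro sets_PiM_I_finite) auto
  have [measurable]: "(\<lambda>u. u(i := d u + (w u - d u) * u i)) \<in>
      measurable (\<Pi>\<^sub>M h\<in>I. lborel) (\<Pi>\<^sub>M h\<in>I. lborel)"
    using \<open>i \<in> I\<close> by (intro measurable_fun_upd[where J = I]) auto
  \<comment> \<open>The cube factorises. A point \<open>x\<close> of the product over
    \<open>J\<close> is extensional on \<open>J\<close>, so \<open>x(i := y)\<close> is extensional
    on \<open>I\<close>, as membership in the cube demands.\<close>
  have cube: "indicator (\<Pi>\<^sub>E h\<in>I. {0<..<1}) (x(i := y)) =
      (indicator {0<..<1} y * indicator (\<Pi>\<^sub>E h\<in>J. {0<..<1}) x :: ennreal)"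
    if "x \<in> space (\<Pi>\<^sub>M h\<in>J. (lborel :: real measure))" for x and y :: real
    using that J unfolding I
    by (auto simp: indicator_def space_PiM PiE_iff extensional_def split: if_splits)
  have fibre: "(\<integral>\<^sup>+y. ennreal (max (w (x(i := y)) - d (x(i := y))) 0) *
        \<phi> ((x(i := y))(i := d (x(i := y)) + (w (x(i := y)) - d (x(i := y))) * (x(i := y)) i)) *
        indicator (\<Pi>\<^sub>E h\<in>I. {0<..<1}) (x(i := y)) \<partial>lborel) =
      (\<integral>\<^sup>+y. \<phi> (x(i := y)) * indicator {d (x(i := y))<..<w (x(i := y))} ((x(i := y)) i) *
        indicator (\<Pi>\<^sub>E h\<in>I. {0<..<1}) (x(i := y)) \<partial>lborel)"
    (is "?L = ?R") if x: "x \<in> space (\<Pi>\<^sub>M h\<in>J. (lborel :: real measure))" for x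
  proof -
    have "(\<lambda>y. x(i := y)) \<in> measurable lborel (\<Pi>\<^sub>M h\<in>I. (lborel :: real measure))"
      unfolding I using measurable_component_update[OF x J(1)] by simp
    from measurable_comp[OF this assms(5)]
    have [measurable]: "(\<lambda>y. \<phi> (x(i := y))) \<in> borel_measurable borel"
      by (simp add: comp_def)
    note assms(5)[measurable del]
    have resampled: "(\<lambda>y. \<phi> (x(i := d x + (w x - d x) * y))) \<in> borel_measurable borel"
      by (rule measurable_compose[of "\<lambda>y. d x + (w x - d x) * y" borel borel]) measurable
    let ?c = "indicator (\<Pi>\<^sub>E h\<in>J. {0<..<1}) x :: ennreal"
    have "?L = (\<integral>\<^sup>+y. ennreal (max (w x - d x) 0) * \<phi> (x(i := d x + (w x - d x) * y)) *
        indicator {0<..<1} y * ?c \<partial>lborel)"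
      \<comment> \<open>The update rules hold for all functions, so \<open>d x\<close> and
        \<open>w x\<close> are the bounds along the fibre even though \<open>x\<close> itself is a
        point of the product over \<open>J\<close>.\<close>
      by (simp add: d_upd w_upd cube[OF x] mult.assoc)
    also have "\<dots> = (\<integral>\<^sup>+y. ennreal (max (w x - d x) 0) * \<phi> (x(i := d x + (w x - d x) * y)) *
        indicator {0<..<1} y \<partial>lborel) * ?c"
      by (intro nn_integral_multc borel_measurable_times_ennreal) (simp_all add: resampled)
    also have "\<dots> = (\<integral>\<^sup>+y. \<phi> (x(i := y)) * indicator {d x<..<w x} y * indicator {0<..<1} y \<partial>lborel) * ?c"
      using assms(8,9) by (subst nn_integral_rescale_unit_interval[of "\<lambda>y. \<phi> (x(i := y))"]) auto
    also have "\<dots> = (\<integral>\<^sup>+y. \<phi> (x(i := y)) * indicator {d x<..<w x} y * indicator {0<..<1} y * ?c \<partial>lborel)"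
      by (intro nn_integral_multc[symmetric] borel_measurable_times_ennreal) simp_all
    also have "\<dots> = ?R"
      by (simp add: d_upd w_upd cube[OF x] mult.assoc)
    finally show ?thesis .
  qed
  have [measurable]: "(\<lambda>u. indicator {d u<..<w u} (u i) :: ennreal) \<in> borel_measurable (\<Pi>\<^sub>M h\<in>I. lborel)"
    unfolding indicator_def greaterThanLessThan_iff by measurable
  have L: "(\<lambda>u. ennreal (max (w u - d u) 0) * \<phi> (u(i := d u + (w u - d u) * u i)) *
      indicator (\<Pi>\<^sub>E h\<in>I. {0<..<1}) u) \<in> borel_measurable (\<Pi>\<^sub>M h\<in>I. lborel)"
    by measurable
  have R: "(\<lambda>u. \<phi> u * indicator {d u<..<w u} (u i) * indicator (\<Pi>\<^sub>E h\<in>I. {0<..<1}) u)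
      \<in> borel_measurable (\<Pi>\<^sub>M h\<in>I. lborel)"
    by measurable
  show ?thesis
    unfolding product_nn_integral_insert[OF J(2,1), folded I, OF L]
      product_nn_integral_insert[OF J(2,1), folded I, OF R]
    by (intro nn_integral_cong fibre)
qed

section \<open>Comparing variances through first and second moments\<close>

text \<open>The means agree, so the variances differ by the expectation of
  \<open>(1 - c) * X\<^sup>2\<close>. This is nonnegative, and it vanishes only if \<open>X\<close>
  is 0 almost everywhere, which a positive mean excludes. The moment hypotheses are nonnegative
  integrals, so they make sense before \<open>Y\<close> is known to be integrable.\<close>

lemma (in prob_space) variance_le_if_weighted_second_moment:
  fixes X Y c :: "'a \<Rightarrow> real"
  assumes [measurable]: "X \<in> borel_measurable M" "Y \<in> borel_measurable M" "c \<in> borel_measurable M"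
    and X: "\<And>\<omega>. 0 \<le> X \<omega>" and Y: "\<And>\<omega>. 0 \<le> Y \<omega>"
    and c: "\<And>\<omega>. 0 \<le> c \<omega>" "\<And>\<omega>. c \<omega> < 1"
    and first: "(\<integral>\<^sup>+\<omega>. Y \<omega> \<partial>M) = (\<integral>\<^sup>+\<omega>. X \<omega> \<partial>M)"
    and second: "(\<integral>\<^sup>+\<omega>. (Y \<omega>)\<^sup>2 \<partial>M) = (\<integral>\<^sup>+\<omega>. c \<omega> * (X \<omega>)\<^sup>2 \<partial>M)"
    and X2: "integrable M (\<lambda>\<omega>. (X \<omega>)\<^sup>2)"
  shows "integrable M (\<lambda>\<omega>. (Y \<omega>)\<^sup>2)" "variance Y \<le> variance X"
    and "0 < expectation X \<Longrightarrow> variance Y < variance X"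
proof -
  \<comment> \<open>Domination by \<open>X\<^sup>2\<close>, as \<open>c\<close> lies between 0 and
    1; through \<open>second\<close> this yields square integrability of \<open>Y\<close>.\<close>
  have cX2: "integrable M (\<lambda>\<omega>. c \<omega> * (X \<omega>)\<^sup>2)"
    using c by (intro Bochner_Integration.integrable_bound[OF X2])
      (auto simp: abs_mult less_imp_le intro!: mult_left_le_one_le)
  then have "(\<integral>\<^sup>+\<omega>. (Y \<omega>)\<^sup>2 \<partial>M) < \<infinity>"
    unfolding second using c by (subst nn_integral_eq_integral) auto
  then show Y2: "integrable M (\<lambda>\<omega>. (Y \<omega>)\<^sup>2)"
    by (intro integrableI_nonneg) auto
  have int: "integrable M X" "integrable M Y"
    using X2 Y2 by (auto intro: square_integrable_imp_integrable)
  have "expectation Y = expectation X"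
    using first X Y by (simp add: integral_eq_nn_integral)
  moreover have "expectation (\<lambda>\<omega>. (Y \<omega>)\<^sup>2) = expectation (\<lambda>\<omega>. c \<omega> * (X \<omega>)\<^sup>2)"
    using second c by (simp add: integral_eq_nn_integral)
  ultimately have "variance X - variance Y =
      expectation (\<lambda>\<omega>. (X \<omega>)\<^sup>2) - expectation (\<lambda>\<omega>. c \<omega> * (X \<omega>)\<^sup>2)"
    unfolding variance_eq[OF int(1) X2] variance_eq[OF int(2) Y2] by simp
  then have diff: "variance X - variance Y = expectation (\<lambda>\<omega>. (1 - c \<omega>) * (X \<omega>)\<^sup>2)"
    using X2 cX2 by (simp add: left_diff_distrib)
  have nonneg: "0 \<le> (1 - c \<omega>) * (X \<omega>)\<^sup>2" for \<omega>
    using c(2)[of \<omega>] by simp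
  have "0 \<le> expectation (\<lambda>\<omega>. (1 - c \<omega>) * (X \<omega>)\<^sup>2)" (is "0 \<le> ?E")
    using nonneg by simp
  with diff show "variance Y \<le> variance X"
    by linarith
  assume "0 < expectation X"
  have "?E \<noteq> 0"
  proof
    assume "?E = 0"
    moreover have "integrable M (\<lambda>\<omega>. (1 - c \<omega>) * (X \<omega>)\<^sup>2)"
      using X2 cX2 by (simp add: left_diff_distrib)
    ultimately have "AE \<omega> in M. (1 - c \<omega>) * (X \<omega>)\<^sup>2 = 0"
      using nonneg by (subst (asm) integral_nonneg_eq_0_iff_AE) auto
    moreover have "1 - c \<omega> \<noteq> 0" for \<omega>
      using c(2)[of \<omega>] by simp
    ultimately have "AE \<omega> in M. X \<omega> = 0"
      by simp
    then have "expectation X = 0"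
      by (rule integral_eq_zero_AE)
    with \<open>0 < expectation X\<close> show False by simp
  qed
  with diff \<open>0 \<le> ?E\<close> show "variance Y < variance X"
    by linarith
qed

section \<open>Measurability of the prices and of the barrier bounds\<close>

text \<open>The summation set \<open>K\<close> is left free so that this covers both the full sum in
  a price and the sum from index 2 on in a barrier quantile.\<close>

lemma borel_measurable_weighted_normal_sum:
  assumes "K \<subseteq> I"
  shows "(\<lambda>u. \<Sum>h\<in>K. a h * std_normal_quantile (u h)) \<in> borel_measurable (\<Pi>\<^sub>M h\<in>I. lborel)"
proof (intro borel_measurable_sum borel_measurable_times borel_measurable_const)
  fix h
  assume "h \<in> K"
  then have "(\<lambda>u. u h) \<in> borel_measurable (\<Pi>\<^sub>M h\<in>I. lborel)"
    using measurable_component_singleton[of h I "\<lambda>_. lborel"] assms by auto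
  then show "(\<lambda>u. std_normal_quantile (u h)) \<in> borel_measurable (\<Pi>\<^sub>M h\<in>I. lborel)"
    by measurable
qed

lemma borel_measurable_asset_price [measurable]:
  "(\<lambda>u. asset_price n m r T S0 \<sigma> A u i j) \<in> borel_measurable (\<Pi>\<^sub>M h\<in>{1..m*n}. lborel)"
proof -
  note borel_measurable_weighted_normal_sum[OF subset_refl, measurable]
  show ?thesis
    unfolding asset_price_def by measurable
qed

lemma measurable_price_array [measurable]:
  "price_array n m r T S0 \<sigma> A \<in>
     measurable (\<Pi>\<^sub>M h\<in>{1..m*n}. lborel) (\<Pi>\<^sub>M p\<in>{1..n} \<times> {1..m}. borel)"
  unfolding price_array_def case_prod_beta by (intro measurable_restrict) measurable

lemma borel_measurable_max_price [measurable]: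
  "max_price n m r T S0 \<sigma> A \<in> borel_measurable (\<Pi>\<^sub>M h\<in>{1..m*n}. lborel)"
  unfolding max_price_def by (intro borel_measurable_Max) measurable

lemma borel_measurable_barrier_quantile [measurable]:
  "(\<lambda>u. barrier_quantile n m r T S0 \<sigma> A B u j) \<in> borel_measurable (\<Pi>\<^sub>M h\<in>{1..m*n}. lborel)"
proof -
  have "{2..m*n} \<subseteq> {1..m*n}"
    by auto
  note borel_measurable_weighted_normal_sum[OF this, measurable]
  show ?thesis
    unfolding barrier_quantile_def by measurable
qed

lemma finite_pos_dates [simp]: "finite (pos_dates m A)"
  by (simp add: pos_dates_def)

lemma borel_measurable_upper_bound [measurable]:
  "upper_bound n m r T S0 \<sigma> A B \<in> borel_measurable (\<Pi>\<^sub>M h\<in>{1..m*n}. lborel)"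
proof -
  have [measurable]: "(\<lambda>u. Min (barrier_quantile n m r T S0 \<sigma> A B u ` pos_dates m A))
      \<in> borel_measurable (\<Pi>\<^sub>M h\<in>{1..m*n}. lborel)"
    by (intro borel_measurable_Min borel_measurable_barrier_quantile) simp
  show ?thesis
    unfolding upper_bound_def by measurable
qed

lemma borel_measurable_lower_bound [measurable]:
  "lower_bound n m r T S0 \<sigma> A B \<in> borel_measurable (\<Pi>\<^sub>M h\<in>{1..m*n}. lborel)"
proof -
  have [measurable]: "(\<lambda>u. Max (barrier_quantile n m r T S0 \<sigma> A B u ` ({1..m} - pos_dates m A)))
      \<in> borel_measurable (\<Pi>\<^sub>M h\<in>{1..m*n}. lborel)"
    by (intro borel_measurable_Max borel_measurable_barrier_quantile) simp
  show ?thesis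
    unfolding lower_bound_def by measurable
qed

section \<open>The bounds on the first coordinate and the barrier condition\<close>

text \<open>The sum starts at \<open>h = 2\<close>, so \<open>u 1\<close> does not occur. This is
  what makes the bounds constants when the first coordinate is integrated out.\<close>

lemma barrier_quantile_upd_1 [simp]:
  "barrier_quantile n m r T S0 \<sigma> A B (u(1 := y)) = barrier_quantile n m r T S0 \<sigma> A B u"
  unfolding barrier_quantile_def by (intro ext) (auto intro!: sum.cong)

lemma upper_bound_upd_1 [simp]:
  "upper_bound n m r T S0 \<sigma> A B (u(1 := y)) = upper_bound n m r T S0 \<sigma> A B u"
  using barrier_quantile_upd_1[of n m r T S0 \<sigma> A B u y] by (simp add: upper_bound_def)

lemma lower_bound_upd_1 [simp]:
  "lower_bound n m r T S0 \<sigma> A B (u(1 := y)) = lower_bound n m r T S0 \<sigma> A B u"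
  using barrier_quantile_upd_1[of n m r T S0 \<sigma> A B u y] by (simp add: lower_bound_def)

lemma upper_bound_le_1: "upper_bound n m r T S0 \<sigma> A B u \<le> 1"
  by (simp add: upper_bound_def std_normal_cdf_bounds less_imp_le)

lemma lower_bound_nonneg: "0 \<le> lower_bound n m r T S0 \<sigma> A B u"
  by (simp add: lower_bound_def std_normal_cdf_bounds less_imp_le)

text \<open>
  There is at least one monitoring date, and it restricts \<open>u\<^sub>1\<close> strictly from one side.
\<close>

lemma bound_width_less_1:
  assumes "m \<ge> 1"
  shows "upper_bound n m r T S0 \<sigma> A B u - lower_bound n m r T S0 \<sigma> A B u < 1"
proof (cases "pos_dates m A = {}")
  case True
  then have "pos_dates m A \<noteq> {1..m}"
    using assms by auto
  then have "0 < lower_bound n m r T S0 \<sigma> A B u"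
    by (simp add: lower_bound_def std_normal_cdf_bounds)
  then show ?thesis
    using upper_bound_le_1[of n m r T S0 \<sigma> A B u] by linarith
next
  case False
  then have "upper_bound n m r T S0 \<sigma> A B u < 1"
    by (simp add: upper_bound_def std_normal_cdf_bounds)
  then show ?thesis
    using lower_bound_nonneg[of n m r T S0 \<sigma> A B u] by linarith
qed

text \<open>After taking logarithms, each date imposes a linear inequality on \<open>z\<close>, the
  normal quantile of \<open>u 1\<close>. Division by \<open>A j 1\<close> keeps or reverses it
  according to sign, so dates in \<open>P\<close> bound \<open>z\<close> from above and the others
  from below. The strictly increasing cdf carries the tightest of these bounds over to
  \<open>u 1\<close>.\<close>

lemma max_price_less_iff_between_bounds:
  assumes "n \<ge> 1" "m \<ge> 1" "B > 0" "S0 1 > 0"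
    and A1: "\<And>j. j \<in> {1..m} \<Longrightarrow> A j 1 \<noteq> 0"
    and u1: "u 1 \<in> {0<..<1}"
  shows "max_price n m r T S0 \<sigma> A u < B \<longleftrightarrow>
    u 1 \<in> {lower_bound n m r T S0 \<sigma> A B u<..<upper_bound n m r T S0 \<sigma> A B u}"
proof -
  define z where "z = std_normal_quantile (u 1)"
  define P where "P = pos_dates m A"
  let ?q = "barrier_quantile n m r T S0 \<sigma> A B u"
  have \<Phi>z: "std_normal_cdf z = u 1"
    unfolding z_def using u1 by (rule std_normal_cdf_quantile)
  have P: "P \<subseteq> {1..m}" "finite P"
    by (auto simp: P_def pos_dates_def)
  have "1 \<le> m * n"
    using assms by simp
  have price: "asset_price n m r T S0 \<sigma> A u 1 j < B \<longleftrightarrow> (if j \<in> P then z < ?q j else ?q j < z)"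
    if j: "j \<in> {1..m}" for j
  proof -
    \<comment> \<open>For asset 1 the row index is \<open>j\<close> itself. Splitting off the term
      \<open>h = 1\<close> isolates \<open>z\<close>; \<open>s\<close> collects the coordinates from
      2 on.\<close>
    define s where "s = (\<Sum>h=2..m*n. A j h * std_normal_quantile (u h))"
    have "(\<Sum>h=1..m*n. A j h * std_normal_quantile (u h)) = A j 1 * z + s"
      using \<open>1 \<le> m * n\<close> by (simp add: sum.atLeast_Suc_atMost z_def s_def numeral_2_eq_2)
    then have "asset_price n m r T S0 \<sigma> A u 1 j < B \<longleftrightarrow>
        exp ((r - (\<sigma> 1)\<^sup>2 / 2) * monitoring_time m T j + (A j 1 * z + s)) < B / S0 1"
      using \<open>S0 1 > 0\<close> by (simp add: asset_price_def row_index_def pos_less_divide_eq mult.commute)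
    also have "\<dots> \<longleftrightarrow> (r - (\<sigma> 1)\<^sup>2 / 2) * monitoring_time m T j + (A j 1 * z + s) < ln (B / S0 1)"
      using \<open>B > 0\<close> \<open>S0 1 > 0\<close> by (metis divide_pos_pos exp_less_cancel_iff exp_ln)
    also have "\<dots> \<longleftrightarrow> A j 1 * z < log_barrier m r T S0 \<sigma> B j - s"
      unfolding log_barrier_def by linarith
    also have "\<dots> \<longleftrightarrow> (if j \<in> P then z < ?q j else ?q j < z)"
    proof (cases "0 < A j 1")
      case True
      with j have "j \<in> P"
        by (simp add: P_def pos_dates_def)
      with True show ?thesis
        by (simp add: barrier_quantile_def s_def pos_less_divide_eq mult.commute)
    next
      case False
      with A1[OF j] have "A j 1 < 0" "j \<notin> P"
        by (simp_all add: P_def pos_dates_def)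
      then show ?thesis
        by (simp add: barrier_quantile_def s_def neg_divide_less_eq mult.commute)
    qed
    finally show ?thesis .
  qed
  have "max_price n m r T S0 \<sigma> A u < B \<longleftrightarrow> (\<forall>j\<in>{1..m}. asset_price n m r T S0 \<sigma> A u 1 j < B)"
    unfolding max_price_def using \<open>m \<ge> 1\<close> by (subst Max_less_iff) auto
  also have "\<dots> \<longleftrightarrow> (\<forall>j\<in>{1..m}. if j \<in> P then z < ?q j else ?q j < z)"
    by (rule ball_cong[OF refl price])
  also have "\<dots> \<longleftrightarrow> (\<forall>j\<in>P. z < ?q j) \<and> (\<forall>j\<in>{1..m} - P. ?q j < z)"
    unfolding if_bool_eq_conj using P(1) by blast
  also have "(\<forall>j\<in>P. z < ?q j) \<longleftrightarrow> u 1 < upper_bound n m r T S0 \<sigma> A B u"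
  proof (cases "P = {}")
    \<comment> \<open>With no date bounding \<open>z\<close> from above, the default bound 1 is met
      because \<open>u 1 < 1\<close>.\<close>
    case True
    with u1 show ?thesis by (simp add: upper_bound_def P_def)
  next
    case False
    then have "(\<forall>j\<in>P. z < ?q j) \<longleftrightarrow> std_normal_cdf z < std_normal_cdf (Min (?q ` P))"
      using P by simp
    with False show ?thesis by (simp add: upper_bound_def P_def[symmetric] \<Phi>z)
  qed
  also have "(\<forall>j\<in>{1..m} - P. ?q j < z) \<longleftrightarrow> lower_bound n m r T S0 \<sigma> A B u < u 1"
  proof (cases "P = {1..m}")
    \<comment> \<open>Likewise, the default lower bound 0 is met because
      \<open>0 < u 1\<close>.\<close>
    case True
    with u1 show ?thesis by (simp add: lower_bound_def P_def)
  next
    case False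
    with P have "{1..m} - P \<noteq> {}" by auto
    then have "(\<forall>j\<in>{1..m} - P. ?q j < z) \<longleftrightarrow>
        std_normal_cdf (Max (?q ` ({1..m} - P))) < std_normal_cdf z"
      by simp
    with False show ?thesis by (simp add: lower_bound_def P_def[symmetric] \<Phi>z)
  qed
  finally show ?thesis by auto
qed


section \<open>Transfer to the cube and comparison of the two estimators\<close>

theorem theorem4:
  fixes M :: "'a measure"
    and U :: "'a \<Rightarrow> nat \<Rightarrow> real"
    and n m :: nat
    and r T B :: real
    and S0 \<sigma> :: "nat \<Rightarrow> real"
    and \<rho> A :: "nat \<Rightarrow> nat \<Rightarrow> real"
    and f :: "(nat \<times> nat \<Rightarrow> real) \<Rightarrow> real"
    and g g2 :: "'a \<Rightarrow> real"
  assumes "n \<ge> 1" and "m \<ge> 1" and "T > 0" and "B > 0"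
    and "\<And>i. i \<in> {1..n} \<Longrightarrow> S0 i > 0"
    and "\<And>i. i \<in> {1..n} \<Longrightarrow> \<sigma> i > 0"
    and "correlation_matrix n \<rho>"
    and "path_matrix n m T \<sigma> \<rho> A"
    and "\<And>j. j \<in> {1..m} \<Longrightarrow> A j 1 \<noteq> 0"
    and "f \<in> borel_measurable (\<Pi>\<^sub>M p\<in>{1..n} \<times> {1..m}. borel)"
    and "prob_space M"
    and "U \<in> measurable M (\<Pi>\<^sub>M h\<in>{1..m*n}. lborel)"
    and "distr M (\<Pi>\<^sub>M h\<in>{1..m*n}. lborel) U =
           uniform_measure (\<Pi>\<^sub>M h\<in>{1..m*n}. lborel) (\<Pi>\<^sub>E h\<in>{1..m*n}. {0<..<1})"
    and g_def: "g = (\<lambda>\<omega>. up_and_out_payoff n m r T S0 \<sigma> A B f (U \<omega>))"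
    and g2_def: "g2 = (\<lambda>\<omega>. conditional_estimator n m r T S0 \<sigma> A B f (U \<omega>))"
    and "integrable M (\<lambda>\<omega>. (g \<omega>)\<^sup>2)"
  shows "integrable M (\<lambda>\<omega>. (g2 \<omega>)\<^sup>2)
    \<and> prob_space.variance M g2 \<le> prob_space.variance M g
    \<and> (measure M {\<omega> \<in> space M. max_price n m r T S0 \<sigma> A (U \<omega>) \<ge> B} > 0
        \<and> prob_space.expectation M g > 0
        \<longrightarrow> prob_space.variance M g2 < prob_space.variance M g)"
proof -
  interpret prob_space M by fact
  interpret product_sigma_finite "\<lambda>_::nat. lborel :: real measure"
    by standard
  define N where "N = (\<Pi>\<^sub>M h\<in>{1..m*n}. (lborel :: real measure))"
  define C where "C = (\<Pi>\<^sub>E h\<in>{1..m*n}. {0<..<1::real})"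
  define G where "G = up_and_out_payoff n m r T S0 \<sigma> A B f"
  define G2 where "G2 = conditional_estimator n m r T S0 \<sigma> A B f"
  define H where "H u = max (f (price_array n m r T S0 \<sigma> A u)) 0" for u
  define d where "d = lower_bound n m r T S0 \<sigma> A B"
  define w where "w = upper_bound n m r T S0 \<sigma> A B"
  define c where "c u = max (w u - d u) 0" for u
  have idx: "1 \<in> {1..m*n}"
    using assms(1,2) by simp
  \<comment> \<open>Keeps the index 1 in the form in which the update rules for
    \<open>u(1 := y)\<close> are stated.\<close>
  note One_nat_def [simp del]
  have upd [simp]: "d (u(1 := y)) = d u" "w (u(1 := y)) = w u" "c (u(1 := y)) = c u" for u y
    by (simp_all only: c_def d_def w_def lower_bound_upd_1 upper_bound_upd_1)
  have bounds: "0 \<le> d u" "w u \<le> 1" for u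
    by (simp_all add: d_def w_def lower_bound_nonneg upper_bound_le_1)
  have c: "0 \<le> c u" "c u < 1" for u
    using bound_width_less_1[OF assms(2)] by (simp_all add: c_def d_def w_def)
  have H: "0 \<le> H u" for u
    by (simp add: H_def)
  have C [measurable]: "C \<in> sets N"
    unfolding C_def N_def by (intro sets_PiM_I_finite) auto
  have [measurable]: "U \<in> measurable M N"
    using assms(12) by (simp add: N_def)
  note assms(10)[measurable]
  have [measurable]: "H \<in> borel_measurable N" "d \<in> borel_measurable N" "w \<in> borel_measurable N"
    unfolding H_def[abs_def] d_def w_def N_def by measurable
  then have [measurable]: "c \<in> borel_measurable N"
    unfolding c_def[abs_def] by measurable
  have [measurable]: "G \<in> borel_measurable N"
    unfolding G_def up_and_out_payoff_def[abs_def] N_def by measurable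
  have [measurable]: "(\<lambda>u. u(1 := d u + (w u - d u) * u 1)) \<in> measurable N N"
  proof -
    have "(\<lambda>u. u 1) \<in> borel_measurable N"
      using measurable_component_singleton[OF idx, of "\<lambda>_. lborel"] by (simp add: N_def)
    then show ?thesis
      unfolding N_def using idx \<open>d \<in> borel_measurable N\<close> \<open>w \<in> borel_measurable N\<close>
      by (intro measurable_fun_upd[where J = "{1..m*n}"]) (auto simp: N_def)
  qed
  have G2_eq: "G2 u = c u * H (u(1 := d u + (w u - d u) * u 1))" for u
    by (simp add: G2_def conditional_estimator_def c_def H_def d_def w_def shifted_first_def)
  have [measurable]: "G2 \<in> borel_measurable N"
    unfolding G2_eq[abs_def] by measurable
  \<comment> \<open>Membership in the cube places \<open>u 1\<close> in the unit interval, where the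
    quantile inverts the cdf; all later integrals carry \<open>indicator C\<close>.\<close>
  have G_eq: "G u = H u * indicator {d u<..<w u} (u 1)" if "u \<in> C" for u
  proof -
    have "u 1 \<in> {0<..<1}"
      using that idx by (auto simp: C_def PiE_iff)
    then have "max_price n m r T S0 \<sigma> A u < B \<longleftrightarrow> u 1 \<in> {d u<..<w u}"
      unfolding d_def w_def using assms by (intro max_price_less_iff_between_bounds) auto
    then show ?thesis
      by (simp add: G_def up_and_out_payoff_def H_def indicator_def)
  qed
  \<comment> \<open>The cube has volume 1, so the uniform law of \<open>U\<close> is Lebesgue
    measure restricted to \<open>C\<close>, without a normalising factor.\<close>
  have law: "(\<integral>\<^sup>+\<omega>. F (U \<omega>) \<partial>M) = (\<integral>\<^sup>+u. F u * indicator C u \<partial>N)"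
    if [measurable]: "F \<in> borel_measurable N" for F
  proof -
    have "emeasure N C = 1"
      unfolding N_def C_def by (subst emeasure_PiM) auto
    moreover have "(\<integral>\<^sup>+\<omega>. F (U \<omega>) \<partial>M) = (\<integral>\<^sup>+u. F u \<partial>uniform_measure N C)"
      using assms(13)[folded N_def C_def, symmetric] by (simp add: nn_integral_distr)
    ultimately show ?thesis
      by (simp add: nn_integral_uniform_measure divide_ennreal_def)
  qed
  have resample: "(\<integral>\<^sup>+u. ennreal (c u) * \<phi> (u(1 := d u + (w u - d u) * u 1)) * indicator C u \<partial>N) =
      (\<integral>\<^sup>+u. \<phi> u * indicator {d u<..<w u} (u 1) * indicator C u \<partial>N)"
    if "\<phi> \<in> borel_measurable N" for \<phi>
    unfolding c_def N_def C_def
    using that \<open>d \<in> borel_measurable N\<close> \<open>w \<in> borel_measurable N\<close> idx bounds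
    by (intro nn_integral_resample_coordinate) (auto simp: N_def)
  have first: "(\<integral>\<^sup>+\<omega>. g2 \<omega> \<partial>M) = (\<integral>\<^sup>+\<omega>. g \<omega> \<partial>M)"
  proof -
    have "(\<integral>\<^sup>+\<omega>. g2 \<omega> \<partial>M) = (\<integral>\<^sup>+u. ennreal (G2 u) * indicator C u \<partial>N)"
      unfolding g2_def G2_def[symmetric] by (intro law) measurable
    also have "\<dots> = (\<integral>\<^sup>+u. ennreal (H u) * indicator {d u<..<w u} (u 1) * indicator C u \<partial>N)"
      using c H resample[of "\<lambda>u. ennreal (H u)"] by (simp add: G2_eq ennreal_mult)
    also have "\<dots> = (\<integral>\<^sup>+u. ennreal (G u) * indicator C u \<partial>N)"
      by (intro nn_integral_cong) (auto simp: G_eq indicator_def)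
    also have "\<dots> = (\<integral>\<^sup>+\<omega>. g \<omega> \<partial>M)"
      unfolding g_def G_def[symmetric] by (intro law[symmetric]) measurable
    finally show ?thesis .
  qed
  have second: "(\<integral>\<^sup>+\<omega>. (g2 \<omega>)\<^sup>2 \<partial>M) = (\<integral>\<^sup>+\<omega>. c (U \<omega>) * (g \<omega>)\<^sup>2 \<partial>M)"
  proof -
    have "(\<integral>\<^sup>+\<omega>. (g2 \<omega>)\<^sup>2 \<partial>M) = (\<integral>\<^sup>+u. ennreal ((G2 u)\<^sup>2) * indicator C u \<partial>N)"
      unfolding g2_def G2_def[symmetric] by (intro law) measurable
    also have "\<dots> = (\<integral>\<^sup>+u. ennreal (c u * (H u)\<^sup>2) * indicator {d u<..<w u} (u 1) * indicator C u \<partial>N)"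
    proof -
      \<comment> \<open>Squaring produces \<open>c\<close> twice: one factor is the Jacobian
        consumed by \<open>resample\<close>, the other stays with \<open>H\<^sup>2\<close>,
        unchanged by resampling since \<open>c\<close> ignores \<open>u 1\<close>.\<close>
      have "ennreal ((G2 u)\<^sup>2) =
          ennreal (c u) * ennreal (c u * (H (u(1 := d u + (w u - d u) * u 1)))\<^sup>2)" for u
        using c by (subst ennreal_mult[symmetric]) (simp_all add: G2_eq power2_eq_square ac_simps)
      then show ?thesis
        using resample[of "\<lambda>u. ennreal (c u * (H u)\<^sup>2)"] by simp
    qed
    \<comment> \<open>The barrier indicator equals its own square, so it can be absorbed into the
      squared payoff.\<close>
    also have "\<dots> = (\<integral>\<^sup>+u. ennreal (c u * (G u)\<^sup>2) * indicator C u \<partial>N)"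
      by (intro nn_integral_cong) (auto simp: G_eq indicator_def)
    also have "\<dots> = (\<integral>\<^sup>+\<omega>. c (U \<omega>) * (g \<omega>)\<^sup>2 \<partial>M)"
      unfolding g_def G_def[symmetric] by (intro law[symmetric]) measurable
    finally show ?thesis .
  qed
  have meas: "g \<in> borel_measurable M" "g2 \<in> borel_measurable M" "(\<lambda>\<omega>. c (U \<omega>)) \<in> borel_measurable M"
    unfolding g_def g2_def G_def[symmetric] G2_def[symmetric] by measurable
  have nonneg: "0 \<le> g \<omega>" "0 \<le> g2 \<omega>" for \<omega>
    by (simp_all add: g_def g2_def up_and_out_payoff_def conditional_estimator_def)
  note var = variance_le_if_weighted_second_moment[OF meas nonneg c first second assms(16)]
  show ?thesis
    by (rule conjI[OF var(1) conjI[OF var(2) impI]], rule var(3), erule conjunct2)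
qed

end
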